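(* Let $f:\mathbb R^d\to\mathbb R$ be continuous and convex, let $V\in\mathbb R^{d\times d}$ be positive definite, $\theta_0\in\mathbb R^d$, $b>0$, and $\mathcal E:=\{\theta\in\mathbb R^d:\|\theta-\theta_0\|_V\le b\}$. If $\tilde\theta\sim\mathcal N(\theta_0,b^2V^{-1})$, then $$\Pr\Big[f(\tilde\theta)\ge\max_{\theta\in\mathcal E}f(\theta)\Big]\ge\frac{1}{4\sqrt{e\pi}}.$$
   Context: $\|x\|_V=\sqrt{x^\top Vx}$. *)

theory Defs
  imports "HOL-Analysis.Analysis"
begin

text \<open>V-norm: norm_V x = sqrt (x^T V x).\<close>
definition vnorm :: "real^'n^'n \<Rightarrow> real^'n \<Rightarrow> real" where
  "vnorm V x = sqrt (x \<bullet> (V *v x))"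

text \<open>Positive definite: symmetric with positive quadratic form on nonzero vectors.\<close>
definition pos_def :: "real^'n^'n \<Rightarrow> bool" where
  "pos_def V \<longleftrightarrow> transpose V = V \<and> (\<forall>x. x \<noteq> 0 \<longrightarrow> x \<bullet> (V *v x) > 0)"

text \<open>Density of the multivariate normal distribution N(mu, S) on R^d.\<close>
definition mvn_density :: "real^'n \<Rightarrow> real^'n^'n \<Rightarrow> real^'n \<Rightarrow> real" where
  "mvn_density mu S x =
     exp (- ((x - mu) \<bullet> (matrix_inv S *v (x - mu))) / 2)
     / sqrt ((2 * pi) ^ CARD('n) * det S)"

text \<open>The multivariate normal distribution N(mu, S) as a measure on R^d.\<close>
definition mvn :: "real^'n \<Rightarrow> real^'n^'n \<Rightarrow> (real^'n) measure" where
  "mvn mu S = density lborel (\<lambda>x. ennreal (mvn_density mu S x))"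

end

theory Submission
  imports Defs "HOL-Probability.Distributions"
begin

text \<open>Let z maximise f on the compact ellipsoid E.  The strict sublevel set {x. f x < f z}
  is open, convex and misses z, so some a \<noteq> 0 has f x \<ge> f z on the half-space
  a \<bullet> (x - z) \<ge> 0.  Let S = b^2 V^-1 be the covariance and sigma = sqrt (a \<bullet> S a).
  Cauchy-Schwarz for the inner product given by S^-1 yields a \<bullet> (z - theta0) \<le> sigma, so the
  event contains the half-space a \<bullet> (theta - theta0) \<ge> sigma.  Gram-Schmidt for S^-1 gives M
  with M^T S^-1 M = I whose k-th column is S a / sigma; substituting theta = theta0 + M u turns
  the Gaussian into the standard one and a \<bullet> (theta - theta0) into sigma u_k.  So the event
  has probability at least P(Z \<ge> 1) for a standard normal Z, and
  P(Z \<ge> 1) \<ge> integral over [1, 2] of s phi(s) / 2 = (phi(1) - phi(2)) / 2 \<ge> 1 / (4 sqrt (e pi)).\<close>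

section \<open>Matrices and positive definite forms\<close>

lemma
  fixes A :: "'a::semiring_1^'n^'n"
  assumes "invertible A"
  shows matrix_inv_right: "A ** matrix_inv A = mat 1"
    and matrix_inv_left: "matrix_inv A ** A = mat 1"
  using assms someI_ex[of "\<lambda>A'. A ** A' = mat 1 \<and> A' ** A = mat 1"]
  unfolding invertible_def matrix_inv_def by blast+

lemma matrix_inv_unique:
  fixes A B :: "'a::field^'n^'n"
  assumes "A ** B = mat 1"
  shows "matrix_inv A = B"
proof -
  have "invertible A"
    using assms invertible_right_inverse by blast
  have "matrix_inv A = matrix_inv A ** (A ** B)"
    using assms by simp
  also have "\<dots> = (matrix_inv A ** A) ** B"
    by (simp add: matrix_mul_assoc)
  also have "\<dots> = B"
    using matrix_inv_left[OF \<open>invertible A\<close>] by simp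
  finally show ?thesis .
qed

lemma pos_def_scaleR:
  assumes "pos_def P" "c > 0"
  shows "pos_def (c *\<^sub>R P)"
  using assms by (simp add: pos_def_def transpose_scalar scaleR_matrix_vector_assoc[symmetric])

lemma continuous_on_matrix_vector_mult [continuous_intros]:
  fixes A :: "real^'n^'m"
  shows "continuous_on S g \<Longrightarrow> continuous_on S (\<lambda>x. A *v g x)"
  by (rule bounded_linear.continuous_on[OF matrix_vector_mul_bounded_linear])

lemma pos_def_invertible:
  assumes "pos_def V"
  shows "invertible V"
proof -
  have "inj ((*v) V)"
  proof (rule injI)
    fix x y
    assume "V *v x = V *v y"
    then have "(x - y) \<bullet> (V *v (x - y)) = 0"
      by (simp add: matrix_vector_mult_diff_distrib)
    then show "x = y"
      using assms unfolding pos_def_def by (metis less_irrefl right_minus_eq)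
  qed
  then show ?thesis
    using matrix_left_invertible_injective invertible_left_inverse by blast
qed

lemma scaled_inverse_matrix:
  assumes "pos_def V" "c \<noteq> 0"
  shows "invertible (c *\<^sub>R matrix_inv V)" "matrix_inv (c *\<^sub>R matrix_inv V) = (1 / c) *\<^sub>R V"
proof -
  have "(c *\<^sub>R matrix_inv V) ** ((1 / c) *\<^sub>R V) = (c * (1 / c)) *\<^sub>R (matrix_inv V ** V)"
    by (simp add: scalar_matrix_assoc[symmetric] matrix_scalar_ac)
  also have "\<dots> = mat 1"
    using assms matrix_inv_left[OF pos_def_invertible[OF assms(1)]] by simp
  finally show "invertible (c *\<^sub>R matrix_inv V)" "matrix_inv (c *\<^sub>R matrix_inv V) = (1 / c) *\<^sub>R V"
    by (auto simp: invertible_right_inverse intro: matrix_inv_unique)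
qed

definition mform :: "real^'n^'n \<Rightarrow> real^'n \<Rightarrow> real^'n \<Rightarrow> real" where
  "mform P x y = x \<bullet> (P *v y)"

lemma mform_left:
  "mform P (x + y) z = mform P x z + mform P y z"
  "mform P (x - y) z = mform P x z - mform P y z"
  "mform P (c *\<^sub>R x) z = c * mform P x z"
  "mform P (sum g I) z = (\<Sum>i\<in>I. mform P (g i) z)"
  "mform P 0 z = 0"
  by (simp_all add: mform_def inner_add_left inner_diff_left inner_sum_left)

lemma mform_right:
  "mform P z (x + y) = mform P z x + mform P z y"
  "mform P z (x - y) = mform P z x - mform P z y"
  "mform P z (c *\<^sub>R x) = c * mform P z x"
  "mform P z (sum g I) = (\<Sum>i\<in>I. mform P z (g i))"
  "mform P z 0 = 0"
  by (simp_all add: mform_def algebra_simps linear_sum[OF matrix_vector_mul_linear] inner_sum_right)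

lemma mform_transpose_mult:
  "(transpose M ** P ** M) $ i $ j = mform P (column i M) (column j M)"
  by (simp add: mform_def column_def matrix_matrix_mult_def matrix_vector_mult_def inner_vec_def
      transpose_def sum_distrib_left sum_distrib_right mult_ac)
     (subst sum.swap, simp add: mult_ac)

context
  fixes M P :: "real^'n^'n"
  assumes whitens: "transpose M ** P ** M = mat 1"
begin

lemma whitening_mform: "mform P (M *v x) (M *v y) = x \<bullet> y"
proof -
  have "mform P (M *v x) (M *v y) = x \<bullet> (transpose M *v (P *v (M *v y)))"
    unfolding mform_def by (metis dot_lmul_matrix inner_commute transpose_matrix_vector)
  also have "\<dots> = x \<bullet> ((transpose M ** P ** M) *v y)"
    by (simp only: matrix_vector_mul_assoc matrix_mul_assoc)
  finally show ?thesis
    using whitens by simp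
qed

lemma whitening_invertible: "invertible M"
  using whitens invertible_left_inverse by (metis matrix_mul_assoc)

lemma whitening_surj: "surj ((*v) M)"
  using whitening_invertible by (simp add: invertible_eq_bij bij_is_surj)

lemma whitening_det: "det M ^ 2 * det P = 1"
  using arg_cong[OF whitens, of det] by (simp add: det_mul power2_eq_square mult_ac)

end

context
  fixes P :: "real^'n^'n"
  assumes pos_def_P: "pos_def P"
begin

abbreviation orth :: "real^'n \<Rightarrow> real^'n \<Rightarrow> bool" where
  "orth x y \<equiv> mform P x y = 0"

lemma mform_commute: "mform P x y = mform P y x"
proof -
  have "mform P x y = (transpose P *v x) \<bullet> y"
    by (simp add: mform_def dot_lmul_matrix)
  then show ?thesis
    using pos_def_P by (simp add: mform_def pos_def_def inner_commute del: transpose_matrix_vector)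
qed

lemma mform_self_pos: "x \<noteq> 0 \<Longrightarrow> 0 < mform P x x"
  using pos_def_P by (simp add: mform_def pos_def_def)

lemma mform_self_nonneg: "0 \<le> mform P x x"
  using mform_self_pos[of x] by (cases "x = 0") (auto simp: mform_right)

lemma mform_self_eq_0_iff: "mform P x x = 0 \<longleftrightarrow> x = 0"
  using mform_self_pos[of x] by (cases "x = 0") (auto simp: mform_right)

lemma orth_residual:
  assumes "pairwise orth S" "finite S" "x \<in> S"
  shows "orth x (a - (\<Sum>y\<in>S. (mform P y a / mform P y y) *\<^sub>R y))"
proof -
  have "mform P x ((mform P y a / mform P y y) *\<^sub>R y) = (if y = x then mform P x a else 0)"
    if "y \<in> S" for y
  proof (cases "y = x")
    case True
    then show ?thesis
      using mform_self_eq_0_iff[of x] by (auto simp: mform_right mform_left)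
  next
    case False
    then have "orth x y"
      using assms that by (auto simp: pairwise_def)
    then show ?thesis
      using False by (simp add: mform_right)
  qed
  then have "mform P x (\<Sum>y\<in>S. (mform P y a / mform P y y) *\<^sub>R y) = mform P x a"
    using assms by (simp add: mform_right)
  then show ?thesis
    by (simp add: mform_right)
qed

lemma orth_extension:
  assumes "finite T" "finite S" "pairwise orth S"
  obtains U where "pairwise orth (S \<union> U)" "span (S \<union> U) = span (S \<union> T)"
  using assms
proof (induction T arbitrary: S thesis)
  case empty
  then show ?case
    by (metis sup_bot_right)
next
  case (insert a T)
  define a' where "a' = a - (\<Sum>y\<in>S. (mform P y a / mform P y y) *\<^sub>R y)"
  have "orth y a'" if "y \<in> S" for y
    unfolding a'_def using insert.prems(3,2) that by (rule orth_residual)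
  then have "pairwise orth (insert a' S)"
    using insert.prems(3) mform_commute[of a'] by (auto simp: pairwise_insert)
  then obtain U where U: "pairwise orth (insert a' S \<union> U)"
    "span (insert a' S \<union> U) = span (insert a' S \<union> T)"
    using insert.IH[of "insert a' S"] insert.prems(2) by blast
  have "a' - a = - (\<Sum>y\<in>S. (mform P y a / mform P y y) *\<^sub>R y)"
    by (simp add: a'_def)
  also have "\<dots> \<in> span (S \<union> T)"
    by (intro span_neg span_sum span_mul span_base) auto
  finally have "a' - a \<in> span (S \<union> T)" .
  then have "span (insert a' (S \<union> T)) = span (insert a (S \<union> T))"
    by (rule eq_span_insert_eq)
  then have "span (S \<union> insert a' U) = span (S \<union> insert a T)"
    using U(2) by simp
  moreover have "pairwise orth (S \<union> insert a' U)"
    using U(1) by (metis Un_insert_left Un_insert_right)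
  ultimately show ?case
    by (rule insert.prems(1)[rotated])
qed

lemma orth_independent:
  assumes "pairwise orth C" "0 \<notin> C"
  shows "independent C"
  unfolding dependent_def
proof clarify
  fix a assume "a \<in> C" "a \<in> span (C - {a})"
  then obtain T u where T: "finite T" "T \<subseteq> C - {a}" "a = (\<Sum>y\<in>T. u y *\<^sub>R y)"
    by (auto simp: span_explicit)
  have "mform P a a = (\<Sum>y\<in>T. u y * mform P a y)"
    by (subst (2) T(3)) (simp add: mform_right)
  also have "\<dots> = 0"
  proof (intro sum.neutral ballI)
    fix y assume "y \<in> T"
    with T(2) have "y \<in> C" "y \<noteq> a" by auto
    with assms(1) \<open>a \<in> C\<close> show "u y * mform P a y = 0"
      by (simp add: pairwise_def)
  qed
  finally have "mform P a a = 0" .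
  moreover have "a \<noteq> 0"
    using assms(2) \<open>a \<in> C\<close> by auto
  ultimately show False
    by (simp add: mform_self_eq_0_iff)
qed

lemma orth_basis_through:
  assumes "v \<noteq> 0"
  obtains C where "v \<in> C" "0 \<notin> C" "pairwise orth C" "finite C" "card C = CARD('n)"
proof -
  obtain U where U: "pairwise orth ({v} \<union> U)" "span ({v} \<union> U) = span ({v} \<union> Basis)"
    using orth_extension[of Basis "{v}"] by auto
  define C where "C = ({v} \<union> U) - {0}"
  have "pairwise orth C"
    using U(1) by (auto simp: C_def pairwise_def)
  then have ind: "independent C"
    by (rule orth_independent) (simp add: C_def)
  have "span C = span ({v} \<union> Basis)"
    using U(2) by (simp add: C_def span_delete_0)
  then have "span C = UNIV"
    using span_mono[of Basis "{v} \<union> Basis"] by auto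
  then have "card C = CARD('n)"
    using ind basis_card_eq_dim[of C UNIV] by simp
  moreover have "finite C"
    using ind by (rule finiteI_independent)
  moreover have "v \<in> C" "0 \<notin> C"
    using assms by (auto simp: C_def)
  ultimately show ?thesis
    using that \<open>pairwise orth C\<close> by blast
qed

lemma orthonormal_frame_through:
  assumes "mform P v v = 1"
  obtains g :: "'n \<Rightarrow> real^'n" and k where "g k = v"
    "\<And>i j. mform P (g i) (g j) = (if i = j then 1 else 0)"
proof -
  have "v \<noteq> 0"
    using assms by (auto simp: mform_right)
  then obtain C where C: "v \<in> C" "0 \<notin> C" "pairwise orth C" "finite C" "card C = CARD('n)"
    by (rule orth_basis_through)
  then obtain f :: "'n \<Rightarrow> real^'n" where f: "bij_betw f UNIV C"
    using finite_same_card_bij[of "UNIV :: 'n set" C] by auto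
  define k where "k = inv_into UNIV f v"
  have "f k = v"
    unfolding k_def using f C(1) by (simp add: bij_betw_inv_into_right)
  have f_pos: "0 < mform P (f j) (f j)" for j
    using bij_betw_apply[OF f, of j] C(2) by (intro mform_self_pos) auto
  have f_orth: "orth (f i) (f j)" if "i \<noteq> j" for i j
  proof -
    have "f i \<noteq> f j"
      using bij_betw_imp_inj_on[OF f] that by (auto dest: inj_onD)
    then show ?thesis
      using C(3) bij_betw_apply[OF f] by (simp add: pairwise_def)
  qed
  define g where "g j = (1 / sqrt (mform P (f j) (f j))) *\<^sub>R f j" for j
  have "g k = v"
    using assms \<open>f k = v\<close> by (simp add: g_def)
  moreover have "mform P (g i) (g j) = (if i = j then 1 else 0)" for i j
  proof (cases "i = j")
    case True
    then show ?thesis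
      using f_pos[of j]
      by (simp add: g_def mform_left mform_right real_sqrt_mult[symmetric] del: real_sqrt_mult)
  next
    case False
    then show ?thesis
      using f_orth[of i j] by (simp add: g_def mform_left mform_right)
  qed
  ultimately show ?thesis
    by (rule that)
qed

lemma whitening_through:
  assumes "mform P v v = 1"
  obtains M :: "real^'n^'n" and k :: 'n where "transpose M ** P ** M = mat 1" "column k M = v"
proof -
  obtain g :: "'n \<Rightarrow> real^'n" and k where g: "g k = v" "\<And>i j. mform P (g i) (g j) = (if i = j then 1 else 0)"
    using orthonormal_frame_through[OF assms] by blast
  define M where "M = (\<chi> i j. g j $ i)"
  have col: "column j M = g j" for j
    by (simp add: M_def column_def vec_eq_iff)
  have "transpose M ** P ** M = mat 1"
    unfolding vec_eq_iff mform_transpose_mult col g(2) by (simp add: mat_def)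
  moreover have "column k M = v"
    using col g(1) by simp
  ultimately show ?thesis
    by (rule that)
qed

lemma whitening_exists:
  obtains M :: "real^'n^'n" where "transpose M ** P ** M = mat 1"
proof -
  define e :: "real^'n" where "e = axis undefined 1"
  have "e \<noteq> 0"
    by (simp add: e_def)
  define v where "v = (1 / sqrt (mform P e e)) *\<^sub>R e"
  have "mform P v v = 1"
    using mform_self_pos[OF \<open>e \<noteq> 0\<close>]
    by (simp add: v_def mform_left mform_right real_sqrt_mult[symmetric] del: real_sqrt_mult)
  then obtain M :: "real^'n^'n" and k :: 'n
    where M: "transpose M ** P ** M = mat 1" and "column k M = v"
    by (rule whitening_through)
  show ?thesis
    by (rule that[OF M])
qed

lemma mform_Cauchy_Schwarz: "(mform P x y)\<^sup>2 \<le> mform P x x * mform P y y"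
proof -
  obtain M :: "real^'n^'n" where M: "transpose M ** P ** M = mat 1"
    by (rule whitening_exists)
  then obtain x' y' where "x = M *v x'" "y = M *v y'"
    using whitening_surj by (metis surjD)
  then show ?thesis
    using Cauchy_Schwarz_ineq[of x' y'] by (simp add: whitening_mform[OF M])
qed

lemma compact_ellipsoid: "compact {x. mform P (x - t) (x - t) \<le> 1}"
proof -
  obtain M :: "real^'n^'n" where M: "transpose M ** P ** M = mat 1"
    by (rule whitening_exists)
  have "{x. mform P (x - t) (x - t) \<le> 1} = (\<lambda>u. t + M *v u) ` cball 0 1"
  proof (intro set_eqI iffI)
    fix x assume "x \<in> {x. mform P (x - t) (x - t) \<le> 1}"
    moreover obtain u where "x = t + M *v u"
      using whitening_surj[OF M] by (metis surjD add.commute diff_add_cancel)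
    ultimately show "x \<in> (\<lambda>u. t + M *v u) ` cball 0 1"
      by (auto simp: whitening_mform[OF M] norm_eq_sqrt_inner intro!: image_eqI[of _ _ u])
  qed (auto simp: whitening_mform[OF M] norm_eq_sqrt_inner)
  also have "compact \<dots>"
    by (intro compact_continuous_image continuous_intros) simp
  finally show ?thesis .
qed

end

section \<open>Linear changes of variables\<close>

lemma det_matrix_shear:
  fixes m n :: "'n::finite"
  assumes "m \<noteq> n"
  shows "det (matrix (\<lambda>x::real^'n. \<chi> i. if i = m then x $ m + x $ n else x $ i)) = 1"
proof -
  have "matrix (\<lambda>x::real^'n. \<chi> i. if i = m then x $ m + x $ n else x $ i)
      = (\<chi> k. if k = m then row m (mat 1) + 1 *s row n (mat 1) else row k (mat 1 :: real^'n^'n))"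
    by (auto simp: matrix_def vec_eq_iff row_def mat_def axis_def)
  also have "det \<dots> = det (mat 1 :: real^'n^'n)"
    by (rule det_row_operation[OF assms])
  finally show ?thesis
    by simp
qed

lemma measure_shear_cbox:
  fixes m n :: "'n::finite"
  assumes "m \<noteq> n"
  defines "h \<equiv> \<lambda>x::real^'n. \<chi> i. if i = m then x $ m + x $ n else x $ i"
  shows "measure lebesgue (h ` cbox a b) = measure lebesgue (cbox a b)"
proof (cases "cbox a b = {}")
  case False
  \<comment> \<open>\<open>measure_shear_interval\<close> needs \<open>0 \<le> a $ n\<close>, so translate the box first\<close>
  define c :: "real^'n" where "c = axis n (- a $ n)"
  have "linear h"
    unfolding h_def by (rule linearI) (auto simp: vec_eq_iff algebra_simps)
  then have "h ` cbox a b = (\<lambda>y. y - h c) ` h ` cbox (c + a) (c + b)"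
    by (force simp: cbox_translation image_comp linear_add)
  then have "measure lebesgue (h ` cbox a b) = measure lebesgue (h ` cbox (c + a) (c + b))"
    by (simp add: measure_translation_subtract)
  also have "\<dots> = measure lebesgue (cbox (c + a) (c + b))"
    unfolding h_def using assms(1) False
    by (intro measure_shear_interval) (auto simp: c_def cbox_translation)
  also have "\<dots> = measure lebesgue (cbox a b)"
    by (simp add: cbox_translation measure_translation)
  finally show ?thesis .
qed simp

lemma measure_swap_cbox:
  fixes m n :: "'n::finite"
  shows "measure lebesgue ((\<lambda>x::real^'n. \<chi> i. x $ Transposition.transpose m n i) ` cbox a b)
    = measure lebesgue (cbox a b)"
proof (cases "cbox a b = {}")
  case False
  let ?h = "\<lambda>x::real^'n. \<chi> i. x $ Transposition.transpose m n i"
  have eq: "?h ` cbox a b = cbox (?h a) (?h b)"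
    by (auto simp: image_iff lambda_swap_Galois mem_box_cart) (metis transpose_involutory)+
  have "?h ` cbox a b \<noteq> {}"
    using False by blast
  then show ?thesis
    using prod.permute[OF permutes_swap_id, where S=UNIV and g="\<lambda>i. (b - a) $ i", symmetric]
    by (simp add: eq content_cbox_cart False)
qed simp

definition scales_volume :: "(real^'n \<Rightarrow> real^'n) \<Rightarrow> bool" where
  "scales_volume f \<longleftrightarrow> (\<forall>S \<in> lmeasurable. f ` S \<in> lmeasurable
     \<and> measure lebesgue (f ` S) = \<bar>det (matrix f)\<bar> * measure lebesgue S)"

lemma scales_volume_from_cboxes:
  fixes f :: "real^'n \<Rightarrow> real^'n"
  assumes "linear f" "\<bar>det (matrix f)\<bar> = 1"
    and "\<And>a b. measure lebesgue (f ` cbox a b) = measure lebesgue (cbox a b)"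
  shows "scales_volume f"
  unfolding scales_volume_def
proof
  fix S :: "(real^'n) set"
  assume "S \<in> lmeasurable"
  have "f ` S \<in> lmeasurable \<and> 1 * measure lebesgue S = measure lebesgue (f ` S)"
    by (rule measure_linear_sufficient[OF assms(1) \<open>S \<in> lmeasurable\<close>]) (simp add: assms(3))
  then show "f ` S \<in> lmeasurable \<and> measure lebesgue (f ` S) = \<bar>det (matrix f)\<bar> * measure lebesgue S"
    using assms(2) by simp
qed

lemma scales_volume_comp:
  fixes f g :: "real^'n \<Rightarrow> real^'n"
  assumes "linear f" "linear g" "scales_volume f" "scales_volume g"
  shows "scales_volume (f \<circ> g)"
  unfolding scales_volume_def
proof
  fix S :: "(real^'n) set"
  assume "S \<in> lmeasurable"
  then have gS: "g ` S \<in> lmeasurable"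
    "measure lebesgue (g ` S) = \<bar>det (matrix g)\<bar> * measure lebesgue S"
    using assms(4) by (auto simp: scales_volume_def)
  then have "f ` g ` S \<in> lmeasurable"
    "measure lebesgue (f ` g ` S) = \<bar>det (matrix f)\<bar> * measure lebesgue (g ` S)"
    using assms(3) by (auto simp: scales_volume_def)
  moreover have "det (matrix (f \<circ> g)) = det (matrix f) * det (matrix g)"
    using matrix_compose[OF assms(2,1)] by (simp add: det_mul)
  ultimately show "(f \<circ> g) ` S \<in> lmeasurable
      \<and> measure lebesgue ((f \<circ> g) ` S) = \<bar>det (matrix (f \<circ> g))\<bar> * measure lebesgue S"
    unfolding image_comp[symmetric] using gS by (simp add: abs_mult)
qed

lemma scales_volume_singular:
  fixes f :: "real^'n \<Rightarrow> real^'n"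
  assumes "linear f" "\<And>x. f x $ i = 0"
  shows "scales_volume f"
proof -
  have "\<not> inj f"
    using assms by (metis linear_injective_imp_surjective one_neq_zero surjE vec_component)
  then have "det (matrix f) = 0" "negligible (f ` S)" for S
    using det_nz_iff_inj[OF assms(1)] negligible_linear_singular_image[OF assms(1)] by simp_all
  then show ?thesis
    by (simp add: scales_volume_def negligible_imp_measurable negligible_imp_measure0)
qed

lemma scales_volume_stretch: "scales_volume (\<lambda>x. \<chi> i. c i * x $ i)"
  by (simp add: scales_volume_def measurable_stretch measure_stretch axis_def matrix_def det_diagonal)

lemma scales_volume_swap: "scales_volume (\<lambda>x::real^'n. \<chi> i. x $ Transposition.transpose m n i)"
proof (rule scales_volume_from_cboxes)
  show "linear (\<lambda>x::real^'n. \<chi> i. x $ Transposition.transpose m n i)"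
    by (rule linearI) (simp_all add: plus_vec_def scaleR_vec_def)
  have "matrix (\<lambda>x::real^'n. \<chi> i. x $ Transposition.transpose m n i)
      = transpose (\<chi> i j. mat 1 $ i $ Transposition.transpose m n j)"
    by (auto simp: matrix_def transpose_def axis_def mat_def vec_eq_iff)
  then show "\<bar>det (matrix (\<lambda>x::real^'n. \<chi> i. x $ Transposition.transpose m n i))\<bar> = 1"
    by (simp add: det_permute_columns permutes_swap_id sign_swap_id abs_mult)
qed (rule measure_swap_cbox)

lemma scales_volume_shear:
  assumes "m \<noteq> n"
  shows "scales_volume (\<lambda>x::real^'n. \<chi> i. if i = m then x $ m + x $ n else x $ i)"
proof (rule scales_volume_from_cboxes)
  show "linear (\<lambda>x::real^'n. \<chi> i. if i = m then x $ m + x $ n else x $ i)"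
    by (rule linearI) (auto simp: vec_eq_iff algebra_simps)
qed (simp_all add: assms det_matrix_shear measure_shear_cbox)

text \<open>The library's \<open>measure_linear_image\<close> requires the index type to be a
  \<open>wellorder\<close>; the elementary-matrix induction works for every finite index type.\<close>

proposition linear_scales_volume:
  fixes f :: "real^'n \<Rightarrow> real^'n"
  assumes "linear f"
  shows "scales_volume f"
  using assms
proof (rule induct_linear_elementary)
  show "scales_volume (f \<circ> g)"
    if "linear f" "linear g" "scales_volume f" "scales_volume g" for f g :: "real^'n \<Rightarrow> real^'n"
    using that by (rule scales_volume_comp)
qed (auto intro: scales_volume_singular scales_volume_stretch scales_volume_swap scales_volume_shear)

lemma lborel_eq_density_distr_affine:
  fixes A :: "real^'n^'n" and t :: "real^'n"
  assumes "invertible A"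
  shows "lborel = density (distr lborel borel (\<lambda>x. t + A *v x)) (\<lambda>_. ennreal \<bar>det A\<bar>)"
proof (rule lborel_eqI)
  let ?T = "\<lambda>x. t + A *v x"
  define B where "B = matrix_inv A"
  have T_borel [measurable]: "?T \<in> borel \<rightarrow>\<^sub>M borel"
    by (intro borel_measurable_continuous_onI continuous_intros)
  fix l u :: "real^'n"
  assume le: "\<And>b. b \<in> Basis \<Longrightarrow> l \<bullet> b \<le> u \<bullet> b"
  have pre: "?T -` box l u = (*v) B ` box (l - t) (u - t)"
  proof (intro set_eqI iffI)
    fix x assume "x \<in> ?T -` box l u"
    then have "A *v x \<in> box (l - t) (u - t)"
      by (auto simp: box_def inner_diff_left algebra_simps)
    moreover have "x = B *v (A *v x)"
      using matrix_inv_left[OF assms] by (simp add: B_def matrix_vector_mul_assoc)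
    ultimately show "x \<in> (*v) B ` box (l - t) (u - t)"
      by blast
  next
    fix x assume "x \<in> (*v) B ` box (l - t) (u - t)"
    then obtain y where "y \<in> box (l - t) (u - t)" "x = B *v y"
      by blast
    moreover have "A *v (B *v y) = y"
      using matrix_inv_right[OF assms] by (simp add: B_def matrix_vector_mul_assoc)
    ultimately show "x \<in> ?T -` box l u"
      by (auto simp: box_def inner_diff_left algebra_simps)
  qed
  have "?T -` box l u \<in> sets borel"
    using measurable_sets[OF T_borel, of "box l u"] by simp
  then have "emeasure lborel (?T -` box l u) = emeasure lebesgue (?T -` box l u)"
    by (simp add: emeasure_completion main_part_sets)
  also have "\<dots> = emeasure lebesgue ((*v) B ` box (l - t) (u - t))"
    by (simp only: pre)
  also have "emeasure lebesgue ((*v) B ` box (l - t) (u - t))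
      = ennreal (\<bar>det B\<bar> * (\<Prod>b\<in>Basis. (u - l) \<bullet> b))"
    using le linear_scales_volume[OF matrix_vector_mul_linear, of B]
    by (simp add: scales_volume_def emeasure_eq_measure2 inner_diff_left box_ne_empty)
  finally have "emeasure lborel (?T -` box l u) = ennreal (\<bar>det B\<bar> * (\<Prod>b\<in>Basis. (u - l) \<bullet> b))" .
  moreover have "det A * det B = 1"
    using matrix_inv_right[OF assms] by (metis B_def det_I det_mul)
  ultimately show "emeasure (density (distr lborel borel ?T) (\<lambda>_. ennreal \<bar>det A\<bar>)) (box l u)
      = (\<Prod>b\<in>Basis. (u - l) \<bullet> b)"
    using le by (simp add: emeasure_density emeasure_distr nn_integral_cmult
        ennreal_mult'[symmetric] abs_mult[symmetric] prod_nonneg inner_diff_left)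
qed simp

lemma nn_integral_lborel_affine:
  fixes A :: "real^'n^'n" and t :: "real^'n"
  assumes "invertible A" and [measurable]: "h \<in> borel_measurable borel"
  shows "(\<integral>\<^sup>+x. h x \<partial>lborel) = ennreal \<bar>det A\<bar> * (\<integral>\<^sup>+u. h (t + A *v u) \<partial>lborel)"
proof -
  have [measurable]: "(\<lambda>x. t + A *v x) \<in> borel \<rightarrow>\<^sub>M borel"
    by (intro borel_measurable_continuous_onI continuous_intros)
  have "(\<integral>\<^sup>+x. h x \<partial>lborel)
      = (\<integral>\<^sup>+x. h x \<partial>density (distr lborel borel (\<lambda>x. t + A *v x)) (\<lambda>_. ennreal \<bar>det A\<bar>))"
    by (subst lborel_eq_density_distr_affine[OF assms(1), of t]) simp
  also have "\<dots> = (\<integral>\<^sup>+u. ennreal \<bar>det A\<bar> * h (t + A *v u) \<partial>lborel)"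
    by (simp add: nn_integral_density nn_integral_distr)
  also have "\<dots> = ennreal \<bar>det A\<bar> * (\<integral>\<^sup>+u. h (t + A *v u) \<partial>lborel)"
    by (rule nn_integral_cmult) simp
  finally show ?thesis .
qed

lemma nn_integral_lborel_prod_cart:
  fixes g :: "'n::finite \<Rightarrow> real \<Rightarrow> ennreal"
  assumes [measurable]: "\<And>i. g i \<in> borel_measurable borel"
  shows "(\<integral>\<^sup>+x. (\<Prod>i\<in>UNIV. g i (x $ i)) \<partial>lborel) = (\<Prod>i\<in>UNIV. \<integral>\<^sup>+s. g i s \<partial>lborel)"
proof -
  define f where "f b = g (THE i. axis i 1 = b)" for b :: "real^'n"
  have f_axis: "f (axis i 1) = g i" for i
    unfolding f_def by (rule arg_cong[where f=g]) (auto simp: axis_eq_axis)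
  have Basis_eq: "(Basis :: (real^'n) set) = (\<lambda>i. axis i 1) ` UNIV"
    by (auto simp: Basis_vec_def)
  have "inj (\<lambda>i::'n. axis i (1::real))"
    by (auto simp: inj_on_def axis_eq_axis)
  moreover have "(\<integral>\<^sup>+x. (\<Prod>b\<in>Basis. f b (x \<bullet> b)) \<partial>lborel) = (\<Prod>b\<in>Basis. (\<integral>\<^sup>+s. f b s \<partial>lborel))"
    by (rule nn_integral_lborel_prod) (auto simp: Basis_eq f_axis)
  ultimately show ?thesis
    unfolding Basis_eq by (simp add: prod.reindex f_axis cart_eq_inner_axis[symmetric])
qed

section \<open>Gaussian measures\<close>

definition std_mvn_density :: "real^'n \<Rightarrow> real" where
  "std_mvn_density u = (\<Prod>i\<in>UNIV. std_normal_density (u $ i))"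

lemma nn_integral_std_mvn_component:
  fixes k :: "'n::finite"
  assumes [measurable]: "g \<in> borel_measurable borel"
  shows "(\<integral>\<^sup>+u. g (u $ k) * ennreal (std_mvn_density u) \<partial>lborel)
    = (\<integral>\<^sup>+s. g s * ennreal (std_normal_density s) \<partial>lborel)"
proof -
  define G where "G i s = (if i = k then g s else 1) * ennreal (std_normal_density s)" for i s
  have [measurable]: "G i \<in> borel_measurable borel" for i
    unfolding G_def by measurable
  have "g (u $ k) * ennreal (std_mvn_density u) = (\<Prod>i\<in>UNIV. G i (u $ i))" for u :: "real^'n"
    by (simp add: G_def std_mvn_density_def prod.distrib prod_ennreal prod.delta)
  then have "(\<integral>\<^sup>+u. g (u $ k) * ennreal (std_mvn_density u) \<partial>lborel)
      = (\<Prod>i\<in>UNIV. \<integral>\<^sup>+s. G i s \<partial>lborel)"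
    by (simp add: nn_integral_lborel_prod_cart)
  also have "\<dots> = (\<Prod>i\<in>UNIV. if i = k then \<integral>\<^sup>+s. g s * ennreal (std_normal_density s) \<partial>lborel else 1)"
    by (intro prod.cong refl) (simp add: G_def nn_integral_eq_integral)
  also have "\<dots> = (\<integral>\<^sup>+s. g s * ennreal (std_normal_density s) \<partial>lborel)"
    by simp
  finally show ?thesis .
qed

lemma std_normal_density_bound:
  "1 / (4 * sqrt (exp 1 * pi)) \<le> (std_normal_density 1 - std_normal_density 2) / 2"
proof -
  have "29 / 8 \<le> exp (3 / 2 :: real)"
    using exp_lower_Taylor_quadratic[of "3 / 2"] by (simp add: power2_eq_square)
  then have "exp (- 3 / 2 :: real) \<le> 8 / 29"
    by (simp add: exp_minus divide_simps)
  moreover have "sqrt 2 \<le> (42 / 29 :: real)"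
    by (rule real_le_lsqrt) (auto simp: power2_eq_square)
  ultimately have "sqrt 2 \<le> 2 * (1 - exp (- 3 / 2 :: real))"
    by argo
  then have "exp (- 1 / 2) * sqrt 2 \<le> exp (- 1 / 2) * (2 * (1 - exp (- 3 / 2 :: real)))"
    by simp
  also have "\<dots> = 2 * (exp (- 1 / 2) - exp (- 2))"
    by (simp add: algebra_simps flip: exp_add)
  finally have key: "exp (- 1 / 2) * sqrt 2 \<le> 2 * (exp (- 1 / 2) - exp (- 2 :: real))" .
  have "exp (1 / 2 :: real) ^ 2 = exp 1"
    by (simp add: power2_eq_square flip: exp_add)
  then have "sqrt (exp 1) = exp (1 / 2 :: real)"
    by (simp add: real_sqrt_unique)
  then have "1 / (4 * sqrt (exp 1 * pi)) = exp (- 1 / 2) / (4 * sqrt pi)"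
    by (simp add: real_sqrt_mult exp_minus divide_simps)
  also have "\<dots> \<le> (exp (- 1 / 2) - exp (- 2)) / (2 * sqrt 2 * sqrt pi)"
    using key by (simp add: divide_simps mult_ac)
  also have "\<dots> = (std_normal_density 1 - std_normal_density 2) / 2"
    by (simp add: std_normal_density_def real_sqrt_mult divide_simps)
  finally show ?thesis .
qed

lemma std_normal_tail_ge:
  "ennreal (1 / (4 * sqrt (exp 1 * pi)))
     \<le> (\<integral>\<^sup>+s. indicator {1..} s * ennreal (std_normal_density s) \<partial>lborel)"
proof -
  \<comment> \<open>on \<open>[1, 2]\<close> the density dominates \<open>s * \<phi> s / 2\<close>, whose antiderivative is \<open>- \<phi> s / 2\<close>\<close>
  define c where "c = 1 / (2 * sqrt (2 * pi))"
  define F where "F s = - c * exp (- s\<^sup>2 / 2)" for s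
  define f where "f s = c * s * exp (- s\<^sup>2 / 2)" for s
  have F': "(F has_real_derivative f s) (at s)" for s
    unfolding F_def f_def by (auto intro!: derivative_eq_intros simp: algebra_simps)
  have "(\<integral>\<^sup>+s. ennreal (f s) * indicator {1..2} s \<partial>lborel) = F 2 - F 1"
    by (rule nn_integral_FTC_Icc[OF _ F']) (auto simp: f_def c_def)
  also have "F 2 - F 1 = (std_normal_density 1 - std_normal_density 2) / 2"
    by (simp add: F_def c_def std_normal_density_def algebra_simps)
  finally have "ennreal (1 / (4 * sqrt (exp 1 * pi)))
      \<le> (\<integral>\<^sup>+s. ennreal (f s) * indicator {1..2} s \<partial>lborel)"
    using std_normal_density_bound by (simp add: ennreal_leI)
  also have "\<dots> \<le> (\<integral>\<^sup>+s. indicator {1..} s * ennreal (std_normal_density s) \<partial>lborel)"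
    by (intro nn_integral_mono)
      (auto simp: indicator_def f_def c_def std_normal_density_def divide_simps intro!: ennreal_leI)
  finally show ?thesis .
qed

lemma std_mvn_density_eq:
  "std_mvn_density u = exp (- (u \<bullet> u) / 2) / sqrt (2 * pi) ^ CARD('n)"
  for u :: "real^'n"
proof -
  have "std_mvn_density u = (\<Prod>i\<in>UNIV. exp (- (u $ i)\<^sup>2 / 2)) / (\<Prod>i\<in>(UNIV::'n set). sqrt (2 * pi))"
    by (simp add: std_mvn_density_def std_normal_density_def prod_dividef)
  then show ?thesis
    by (simp add: exp_sum[symmetric] sum_divide_distrib sum_negf inner_vec_def power2_eq_square)
qed

lemma mvn_density_whitened:
  fixes S M :: "real^'n^'n"
  assumes "invertible S" and whitens: "transpose M ** matrix_inv S ** M = mat 1"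
  shows "\<bar>det M\<bar> * mvn_density t S (t + M *v u) = std_mvn_density u"
proof -
  have "det S * det (matrix_inv S) = 1"
    using matrix_inv_right[OF assms(1)] by (metis det_I det_mul)
  then have "det (matrix_inv S) \<noteq> 0"
    by auto
  moreover have "det S * det (matrix_inv S) = (det M)\<^sup>2 * det (matrix_inv S)"
    using whitening_det[OF whitens] \<open>det S * _ = 1\<close> by simp
  ultimately have det_S: "det S = (det M)\<^sup>2"
    by simp
  then have "det M \<noteq> 0"
    using \<open>det S * _ = 1\<close> by auto
  have "sqrt ((2 * pi) ^ CARD('n) * det S) = sqrt (2 * pi) ^ CARD('n) * \<bar>det M\<bar>"
    by (simp only: det_S real_sqrt_mult real_sqrt_abs real_sqrt_power[of "2 * pi"])
  moreover have "(t + M *v u - t) \<bullet> (matrix_inv S *v (t + M *v u - t)) = u \<bullet> u"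
    using whitening_mform[OF whitens, of u u] by (simp add: mform_def)
  ultimately show ?thesis
    using \<open>det M \<noteq> 0\<close> by (simp add: mvn_density_def std_mvn_density_eq)
qed

lemma nn_integral_mvn:
  fixes S M :: "real^'n^'n"
  assumes "invertible S" and whitens: "transpose M ** matrix_inv S ** M = mat 1"
    and [measurable]: "h \<in> borel_measurable borel"
  shows "(\<integral>\<^sup>+x. h x \<partial>mvn t S) = (\<integral>\<^sup>+u. h (t + M *v u) * ennreal (std_mvn_density u) \<partial>lborel)"
proof -
  have [measurable]: "(\<lambda>u. t + M *v u) \<in> borel_measurable borel"
    by (intro borel_measurable_continuous_onI continuous_intros)
  have [measurable]: "mvn_density t S \<in> borel_measurable borel"
    unfolding mvn_density_def[abs_def] divide_inverse
    by (intro borel_measurable_continuous_onI continuous_intros)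
  have "(\<integral>\<^sup>+x. h x \<partial>mvn t S) = (\<integral>\<^sup>+x. h x * ennreal (mvn_density t S x) \<partial>lborel)"
    by (simp add: mvn_def nn_integral_density mult.commute)
  also have "\<dots> = ennreal \<bar>det M\<bar>
      * (\<integral>\<^sup>+u. h (t + M *v u) * ennreal (mvn_density t S (t + M *v u)) \<partial>lborel)"
    by (rule nn_integral_lborel_affine[OF whitening_invertible[OF whitens]]) measurable
  also have "\<dots> = (\<integral>\<^sup>+u. ennreal \<bar>det M\<bar>
      * (h (t + M *v u) * ennreal (mvn_density t S (t + M *v u))) \<partial>lborel)"
    by (rule nn_integral_cmult[symmetric]) measurable
  also have "\<dots> = (\<integral>\<^sup>+u. h (t + M *v u) * ennreal (std_mvn_density u) \<partial>lborel)"
  proof (rule nn_integral_cong)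
    fix u
    have "ennreal \<bar>det M\<bar> * ennreal (mvn_density t S (t + M *v u)) = ennreal (std_mvn_density u)"
      using mvn_density_whitened[OF assms(1,2), of t u] by (simp add: ennreal_mult'[symmetric])
    then show "ennreal \<bar>det M\<bar> * (h (t + M *v u) * ennreal (mvn_density t S (t + M *v u)))
        = h (t + M *v u) * ennreal (std_mvn_density u)"
      by (subst mult.left_commute) simp
  qed
  finally show ?thesis .
qed

context
  fixes S :: "real^'n^'n"
  assumes invertible_S: "invertible S" and pos_def_precision: "pos_def (matrix_inv S)"
begin

lemma prob_space_mvn: "prob_space (mvn t S)"
proof
  obtain M :: "real^'n^'n" where M: "transpose M ** matrix_inv S ** M = mat 1"
    using whitening_exists[OF pos_def_precision] by blast
  have "emeasure (mvn t S) (space (mvn t S)) = (\<integral>\<^sup>+x. 1 \<partial>mvn t S)"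
    by simp
  also have "\<dots> = (\<integral>\<^sup>+u. (\<lambda>_. 1) (u $ undefined) * ennreal (std_mvn_density (u :: real^'n)) \<partial>lborel)"
    using nn_integral_mvn[OF invertible_S M, of "\<lambda>_. 1" t] by simp
  also have "\<dots> = (\<integral>\<^sup>+s. 1 * ennreal (std_normal_density s) \<partial>lborel)"
    by (rule nn_integral_std_mvn_component) simp
  also have "\<dots> = 1"
    by (simp add: nn_integral_eq_integral)
  finally show "emeasure (mvn t S) (space (mvn t S)) = 1" .
qed

lemma mform_precision_self: "mform (matrix_inv S) (S *v a) (S *v a) = a \<bullet> (S *v a)"
  using matrix_inv_left[OF invertible_S]
  by (simp add: mform_def matrix_vector_mul_assoc inner_commute)

lemma precision_mult_covariance: "matrix_inv S *v (S *v a) = a"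
  using matrix_inv_left[OF invertible_S] by (simp add: matrix_vector_mul_assoc)

lemma covariance_form_pos: "a \<noteq> 0 \<Longrightarrow> 0 < a \<bullet> (S *v a)"
  using mform_self_pos[OF pos_def_precision, of "S *v a"] mform_precision_self
    precision_mult_covariance[of a] by force

lemma covariance_form_nonneg: "0 \<le> a \<bullet> (S *v a)"
  using covariance_form_pos[of a] by (cases "a = 0") auto

lemma nn_integral_mvn_linear_functional:
  assumes "a \<noteq> 0" and [measurable]: "g \<in> borel_measurable borel"
  shows "(\<integral>\<^sup>+x. g (a \<bullet> (x - t)) \<partial>mvn t S)
    = (\<integral>\<^sup>+s. g (sqrt (a \<bullet> (S *v a)) * s) * ennreal (std_normal_density s) \<partial>lborel)"
proof -
  let ?P = "matrix_inv S"
  define \<sigma> where "\<sigma> = sqrt (a \<bullet> (S *v a))"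
  have "0 < \<sigma>"
    using covariance_form_pos[OF assms(1)] by (simp add: \<sigma>_def)
  define v where "v = (1 / \<sigma>) *\<^sub>R (S *v a)"
  have "mform ?P v v = 1"
    using \<open>0 < \<sigma>\<close> mform_precision_self
    by (simp add: v_def mform_left mform_right \<sigma>_def power2_eq_square[symmetric])
  then obtain M :: "real^'n^'n" and k :: 'n where
    M: "transpose M ** ?P ** M = mat 1" and "column k M = v"
    by (rule whitening_through[OF pos_def_precision])
  have "a \<bullet> (M *v u) = \<sigma> * u $ k" for u
  proof -
    have "S *v a = \<sigma> *\<^sub>R (M *v axis k 1)"
      using \<open>column k M = v\<close> \<open>0 < \<sigma>\<close> by (simp add: matrix_vector_mult_basis v_def)
    then have "mform ?P (M *v u) (S *v a) = \<sigma> * (u \<bullet> axis k 1)"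
      by (simp add: mform_right whitening_mform[OF M])
    then show ?thesis
      using precision_mult_covariance[of a] by (simp add: mform_def inner_commute inner_axis)
  qed
  then have "(\<integral>\<^sup>+x. g (a \<bullet> (x - t)) \<partial>mvn t S)
      = (\<integral>\<^sup>+u. g (\<sigma> * u $ k) * ennreal (std_mvn_density u) \<partial>lborel)"
    by (simp add: nn_integral_mvn[OF invertible_S M])
  also have "\<dots> = (\<integral>\<^sup>+s. g (\<sigma> * s) * ennreal (std_normal_density s) \<partial>lborel)"
    by (rule nn_integral_std_mvn_component) measurable
  finally show ?thesis
    by (simp add: \<sigma>_def)
qed

lemma emeasure_mvn_halfspace:
  assumes "a \<noteq> 0"
  shows "emeasure (mvn t S) {x. sqrt (a \<bullet> (S *v a)) \<le> a \<bullet> (x - t)}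
    = (\<integral>\<^sup>+s. indicator {1..} s * ennreal (std_normal_density s) \<partial>lborel)"
proof -
  define \<sigma> where "\<sigma> = sqrt (a \<bullet> (S *v a))"
  have "0 < \<sigma>"
    using covariance_form_pos[OF assms] by (simp add: \<sigma>_def)
  have "{x. \<sigma> \<le> a \<bullet> (x - t)} \<in> sets (mvn t S)"
    by (simp add: mvn_def)
  then have "emeasure (mvn t S) {x. \<sigma> \<le> a \<bullet> (x - t)}
      = (\<integral>\<^sup>+x. indicator {\<sigma>..} (a \<bullet> (x - t)) \<partial>mvn t S)"
    by (simp add: nn_integral_indicator[symmetric] indicator_def)
  also have "\<dots> = (\<integral>\<^sup>+s. indicator {\<sigma>..} (\<sigma> * s) * ennreal (std_normal_density s) \<partial>lborel)"
    unfolding \<sigma>_def by (rule nn_integral_mvn_linear_functional[OF assms]) simp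
  also have "\<dots> = (\<integral>\<^sup>+s. indicator {1..} s * ennreal (std_normal_density s) \<partial>lborel)"
    using \<open>0 < \<sigma>\<close> by (intro nn_integral_cong) (simp add: indicator_def)
  finally show ?thesis
    by (simp add: \<sigma>_def)
qed

lemma inner_le_on_ellipsoid:
  assumes "mform (matrix_inv S) y y \<le> 1"
  shows "a \<bullet> y \<le> sqrt (a \<bullet> (S *v a))"
proof -
  have "mform (matrix_inv S) y (S *v a) = a \<bullet> y"
    using precision_mult_covariance[of a] by (simp add: mform_def inner_commute)
  then have "(a \<bullet> y)\<^sup>2 \<le> mform (matrix_inv S) y y * (a \<bullet> (S *v a))"
    using mform_Cauchy_Schwarz[OF pos_def_precision, of y "S *v a"] mform_precision_self by simp
  also have "\<dots> \<le> a \<bullet> (S *v a)"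
    using assms covariance_form_nonneg[of a] mform_self_nonneg[OF pos_def_precision]
    by (intro mult_left_le_one_le)
  finally show ?thesis
    by (simp add: real_le_rsqrt)
qed

end

section \<open>Convex functions and the main theorem\<close>

lemma convex_on_strict_sublevel:
  assumes "convex_on UNIV f"
  shows "convex {x. f x < c}"
  unfolding convex_alt
proof (intro ballI allI impI)
  fix x y and u :: real
  assume "x \<in> {x. f x < c}" "y \<in> {x. f x < c}" "0 \<le> u \<and> u \<le> 1"
  then have "(1 - u) * f x + u * f y < c"
    by (intro convex_bound_lt) auto
  moreover have "f ((1 - u) *\<^sub>R x + u *\<^sub>R y) \<le> (1 - u) * f x + u * f y"
    using \<open>0 \<le> u \<and> u \<le> 1\<close> by (intro convex_onD[OF assms]) auto
  ultimately show "(1 - u) *\<^sub>R x + u *\<^sub>R y \<in> {x. f x < c}"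
    by simp
qed

lemma continuous_convex_supporting_halfspace:
  fixes f :: "'a::euclidean_space \<Rightarrow> real"
  assumes "continuous_on UNIV f" "convex_on UNIV f"
  obtains a where "a \<noteq> 0" "\<And>x. 0 \<le> a \<bullet> (x - z) \<Longrightarrow> f z \<le> f x"
proof -
  let ?L = "{x. f x < f z}"
  have "convex ((\<lambda>x. x - z) ` ?L)"
    by (intro convex_translation_subtract convex_on_strict_sublevel assms(2))
  moreover have "0 \<notin> (\<lambda>x. x - z) ` ?L"
    by auto
  ultimately obtain b where "b \<noteq> 0" and "\<forall>y \<in> (\<lambda>x. x - z) ` ?L. 0 \<le> b \<bullet> y"
    using separating_hyperplane_set_0 by blast
  then have b: "0 \<le> b \<bullet> (x - z)" if "f x < f z" for x
    using that by blast
  have "f z \<le> f x" if "b \<bullet> (x - z) \<le> 0" for x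
  proof (rule ccontr)
    assume "\<not> f z \<le> f x"
    then have "x \<in> ?L"
      by simp
    moreover have "open ?L"
      using assms(1) by (intro open_Collect_less) (auto intro: continuous_intros)
    ultimately obtain e where "e > 0" "ball x e \<subseteq> ?L"
      using open_contains_ball by blast
    define x' where "x' = x - (e / 2 / norm b) *\<^sub>R b"
    have "dist x x' < e"
      using \<open>e > 0\<close> \<open>b \<noteq> 0\<close> by (simp add: x'_def dist_norm)
    then have "x' \<in> ?L"
      using \<open>ball x e \<subseteq> ?L\<close> by (auto simp: ball_def)
    then have "0 \<le> b \<bullet> (x' - z)"
      by (simp add: b)
    also have "b \<bullet> (x' - z) = b \<bullet> (x - z) - e / 2 * norm b"
      using \<open>b \<noteq> 0\<close> by (simp add: x'_def inner_diff_right power2_norm_eq_inner[symmetric]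
          power2_eq_square)
    finally have "e / 2 * norm b \<le> b \<bullet> (x - z)"
      by simp
    moreover have "0 < e / 2 * norm b"
      using \<open>e > 0\<close> \<open>b \<noteq> 0\<close> by simp
    ultimately show False
      using that by linarith
  qed
  then show ?thesis
    using that[of "- b"] \<open>b \<noteq> 0\<close> by (simp add: inner_minus_left)
qed

lemma measure_mvn_superlevel_of_max_on_ellipsoid:
  fixes S :: "real^'n^'n" and f :: "real^'n \<Rightarrow> real"
  assumes "invertible S" "pos_def (matrix_inv S)"
    and "continuous_on UNIV f" "convex_on UNIV f"
    and E: "E = {x. mform (matrix_inv S) (x - t) (x - t) \<le> 1}"
  shows "1 / (4 * sqrt (exp 1 * pi)) \<le> measure (mvn t S) {x. (SUP y\<in>E. f y) \<le> f x}"
proof -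
  interpret prob_space "mvn t S"
    by (rule prob_space_mvn[OF assms(1,2)])
  have "compact E" "t \<in> E"
    using compact_ellipsoid[OF assms(2)] by (simp_all add: E mform_left)
  then obtain z where "z \<in> E" and z: "\<And>y. y \<in> E \<Longrightarrow> f y \<le> f z"
    using continuous_attains_sup[of E f] continuous_on_subset[OF assms(3)] by blast
  then have "(SUP y\<in>E. f y) = f z"
    by (intro cSup_eq_maximum) auto
  obtain a where "a \<noteq> 0" and a: "\<And>x. 0 \<le> a \<bullet> (x - z) \<Longrightarrow> f z \<le> f x"
    using continuous_convex_supporting_halfspace[OF assms(3,4)] by blast
  have "a \<bullet> (z - t) \<le> sqrt (a \<bullet> (S *v a))"
    using \<open>z \<in> E\<close> by (intro inner_le_on_ellipsoid[OF assms(1,2)]) (simp add: E)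
  then have "{x. sqrt (a \<bullet> (S *v a)) \<le> a \<bullet> (x - t)} \<subseteq> {x. (SUP y\<in>E. f y) \<le> f x}"
    using a \<open>(SUP y\<in>E. f y) = f z\<close> by (auto simp: inner_diff_right)
  then have halfspace_le: "emeasure (mvn t S) {x. sqrt (a \<bullet> (S *v a)) \<le> a \<bullet> (x - t)}
      \<le> emeasure (mvn t S) {x. (SUP y\<in>E. f y) \<le> f x}"
    using assms(3)
    by (intro emeasure_mono) (auto simp: mvn_def intro!: borel_closed closed_Collect_le continuous_intros)
  have "ennreal (1 / (4 * sqrt (exp 1 * pi)))
      \<le> (\<integral>\<^sup>+s. indicator {1..} s * ennreal (std_normal_density s) \<partial>lborel)"
    by (rule std_normal_tail_ge)
  also have "\<dots> = emeasure (mvn t S) {x. sqrt (a \<bullet> (S *v a)) \<le> a \<bullet> (x - t)}"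
    by (rule emeasure_mvn_halfspace[OF assms(1,2) \<open>a \<noteq> 0\<close>, symmetric])
  also have "\<dots> \<le> emeasure (mvn t S) {x. (SUP y\<in>E. f y) \<le> f x}"
    by (rule halfspace_le)
  also have "\<dots> = ennreal (measure (mvn t S) {x. (SUP y\<in>E. f y) \<le> f x})"
    by (rule emeasure_eq_measure)
  finally show ?thesis
    by simp
qed

theorem mainTheorem5:
  fixes f :: "real^'n \<Rightarrow> real" and V :: "real^'n^'n"
    and theta0 :: "real^'n" and b :: real and E :: "(real^'n) set"
  assumes "continuous_on UNIV f" and "convex_on UNIV f"
    and "pos_def V" and "b > 0"
    and "E = {theta. vnorm V (theta - theta0) \<le> b}"
  shows "measure (mvn theta0 ((b^2) *\<^sub>R matrix_inv V))
           {theta. f theta \<ge> (SUP theta\<in>E. f theta)}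
         \<ge> 1 / (4 * sqrt (exp 1 * pi))"
proof -
  define S where "S = b\<^sup>2 *\<^sub>R matrix_inv V"
  have S: "invertible S" "matrix_inv S = (1 / b\<^sup>2) *\<^sub>R V"
    using scaled_inverse_matrix[OF assms(3), of "b\<^sup>2"] assms(4) by (simp_all add: S_def)
  then have precision: "pos_def (matrix_inv S)"
    using assms(3,4) by (simp add: pos_def_scaleR)
  have "vnorm V x \<le> b \<longleftrightarrow> mform (matrix_inv S) x x \<le> 1" for x
    using real_sqrt_le_iff[of "x \<bullet> (V *v x)" "b\<^sup>2"] assms(4)
    by (simp add: S vnorm_def mform_def scaleR_matrix_vector_assoc[symmetric] pos_divide_le_eq)
  then have "E = {x. mform (matrix_inv S) (x - theta0) (x - theta0) \<le> 1}"
    using assms(5) by simp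
  from measure_mvn_superlevel_of_max_on_ellipsoid[OF S(1) precision assms(1,2) this]
  show ?thesis
    by (simp add: S_def)
qed

end
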